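(* Let $N\ge3$, $k>0$, $\alpha>\frac{N+1}{2}$, and let $f:\mathbb{R}^N\times\mathbb{C}\to\mathbb{C}$ be a continuous function satisfying $$\sup_{|u|\le M,\,x\in\mathbb{R}^N}\langle x\rangle^\alpha|f(x,u)|<\infty\qquad\text{for all } M>0$$ and the Lipschitz condition $$\ell_\alpha:=\sup\Big\{\langle x\rangle^\alpha\Big|\frac{f(x,u)-f(x,v)}{u-v}\Big|:\ u,v\in\mathbb{C},\ u\ne v,\ x\in\mathbb{R}^N\Big\}<\frac{1}{\kappa_\alpha}.$$ Then, for any given solution $\varphi\in L^\infty(\mathbb{R}^N)$ of the homogeneous Helmholtz equation $\Delta\varphi+k^2\varphi=0$, the equation $$u=\mathcal{R}_k(N_f(u))+\varphi$$ admits precisely one solution $u\in L^\infty(\mathbb{R}^N)$.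
   Context: $L^\infty(\mathbb{R}^N)$ consists of complex-valued functions, and $\langle x\rangle=(1+|x|^2)^{1/2}$. For $\alpha\in\mathbb{R}$, $L^\infty_\alpha(\mathbb{R}^N)$ is the space of measurable $w:\mathbb{R}^N\to\mathbb{C}$ with $\|w\|_{L^\infty_\alpha}:=\|\langle\cdot\rangle^\alpha w\|_{L^\infty(\mathbb{R}^N)}<\infty$. The outgoing fundamental solution is $$\Phi_k(x)=\frac{i}{4}\Big(\frac{k}{2\pi|x|}\Big)^{\frac{N-2}{2}}H^{(1)}_{\frac{N-2}{2}}(k|x|),\qquad x\in\mathbb{R}^N\setminus\{0\},$$ where $H^{(1)}_\nu$ is the Hankel function of the first kind of order $\nu$, and $\mathcal{R}_kf=\Phi_k*f$. $N_f$ is the substitution operator $N_f(u)(x)=f(x,u(x))$. For $\alpha>\frac{N+1}{2}$ set $\tau(\alpha)=\alpha-\frac{N+1}{2}$ if $\frac{N+1}{2}<\alpha<N$ and $\tau(\alpha)=\frac{N-1}{2}$ if $\alpha\ge N$, and $$\kappa_\alpha:=\sup\Big\{\big\||\Phi_k|*w\big\|_{L^\infty_{\tau(\alpha)}}:\ w\in L^\infty_\alpha(\mathbb{R}^N),\ \|w\|_{L^\infty_\alpha}=1\Big\}.$$ *)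

theory Defs
  imports "HOL-Probability.Essential_Supremum"
begin

text \<open>
  Bessel and Hankel functions of real order \<^term>\<open>\<nu>\<close> and positive real argument \<^term>\<open>r\<close>.
  Since \<^const>\<open>rGamma\<close> is the entire function 1/Gamma, the ascending series for J is meaningful
  for every real order.
\<close>

definition bessel_J :: "real \<Rightarrow> real \<Rightarrow> real" where
  "bessel_J \<nu> r =
    (\<Sum>m. (- 1) ^ m / fact m * rGamma (real m + \<nu> + 1) * (r / 2) powr (2 * real m + \<nu>))"

text \<open>
  For integer order the usual quotient is of the form 0/0, and Y is defined as its
  limit in the order.
\<close>

definition bessel_Y_quotient :: "real \<Rightarrow> real \<Rightarrow> real" where
  "bessel_Y_quotient \<mu> r =
    (bessel_J \<mu> r * cos (\<mu> * pi) - bessel_J (- \<mu>) r) / sin (\<mu> * pi)"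

definition bessel_Y :: "real \<Rightarrow> real \<Rightarrow> real" where
  "bessel_Y \<nu> r =
    (if \<nu> \<in> \<int> then Lim (at \<nu>) (\<lambda>\<mu>. bessel_Y_quotient \<mu> r) else bessel_Y_quotient \<nu> r)"

definition hankel1 :: "real \<Rightarrow> real \<Rightarrow> complex" where
  "hankel1 \<nu> r = Complex (bessel_J \<nu> r) (bessel_Y \<nu> r)"

text \<open>The value at the origin is irrelevant, since \<^term>\<open>{0}\<close> is a null set.\<close>

definition Phi :: "real \<Rightarrow> real ^ 'n \<Rightarrow> complex" where
  "Phi k x = \<i> / 4
     * of_real ((k / (2 * pi * norm x)) powr ((real CARD('n) - 2) / 2))
     * hankel1 ((real CARD('n) - 2) / 2) (k * norm x)"

definition japanese :: "real ^ 'n \<Rightarrow> real" where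
  "japanese x = sqrt (1 + (norm x)\<^sup>2)"

definition Linf_norm :: "(real ^ 'n \<Rightarrow> complex) \<Rightarrow> ennreal" where
  "Linf_norm w = esssup lebesgue (\<lambda>x. ennreal (cmod (w x)))"

definition wLinf_norm :: "real \<Rightarrow> (real ^ 'n \<Rightarrow> complex) \<Rightarrow> ennreal" where
  "wLinf_norm \<alpha> w = Linf_norm (\<lambda>x. of_real (japanese x powr \<alpha>) * w x)"

definition Linf :: "(real ^ 'n \<Rightarrow> complex) set" where
  "Linf = {w \<in> borel_measurable lebesgue. Linf_norm w < \<infinity>}"

definition wLinf :: "real \<Rightarrow> (real ^ 'n \<Rightarrow> complex) set" where
  "wLinf \<alpha> = {w \<in> borel_measurable lebesgue. wLinf_norm \<alpha> w < \<infinity>}"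

text \<open>
  The Lebesgue integral of HOL is 0 for a non-integrable integrand, so existence of a convolution
  (absolute convergence almost everywhere) is recorded separately.
\<close>

definition convolution ::
    "(real ^ 'n \<Rightarrow> complex) \<Rightarrow> (real ^ 'n \<Rightarrow> complex) \<Rightarrow> real ^ 'n \<Rightarrow> complex" where
  "convolution g w x = (LINT y|lebesgue. g (x - y) * w y)"

definition convolution_exists ::
    "(real ^ 'n \<Rightarrow> complex) \<Rightarrow> (real ^ 'n \<Rightarrow> complex) \<Rightarrow> bool" where
  "convolution_exists g w \<longleftrightarrow>
    (AE x in lebesgue. integrable lebesgue (\<lambda>y. g (x - y) * w y))"

definition resolvent :: "real \<Rightarrow> (real ^ 'n \<Rightarrow> complex) \<Rightarrow> real ^ 'n \<Rightarrow> complex" where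
  "resolvent k w = convolution (Phi k) w"

definition substitution ::
    "(real ^ 'n \<Rightarrow> complex \<Rightarrow> complex) \<Rightarrow> (real ^ 'n \<Rightarrow> complex) \<Rightarrow> real ^ 'n \<Rightarrow> complex" where
  "substitution f u x = f x (u x)"

definition tau :: "'n::finite itself \<Rightarrow> real \<Rightarrow> real" where
  "tau _ \<alpha> = (if \<alpha> < real CARD('n) then \<alpha> - (real CARD('n) + 1) / 2
              else (real CARD('n) - 1) / 2)"

text \<open>
  A convolution that fails to converge is given norm \<^term>\<open>\<infinity> :: ennreal\<close>,
  rather than the norm of the default value 0 of the integral. For the parameters of interest
  every convolution in the supremum converges.
\<close>

definition kappa :: "'n::finite itself \<Rightarrow> real \<Rightarrow> real \<Rightarrow> ennreal" where
  "kappa N k \<alpha> =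
    (SUP w \<in> {w :: real ^ 'n \<Rightarrow> complex. w \<in> wLinf \<alpha> \<and> wLinf_norm \<alpha> w = 1}.
       let g = (\<lambda>x. of_real (cmod (Phi k x)))
       in if convolution_exists g w then wLinf_norm (tau N \<alpha>) (convolution g w) else \<infinity>)"

definition lipschitz_sup :: "real \<Rightarrow> (real ^ 'n \<Rightarrow> complex \<Rightarrow> complex) \<Rightarrow> ennreal" where
  "lipschitz_sup \<alpha> f =
    (SUP (x, u, v) \<in> {(x, u, v). u \<noteq> v}.
       ennreal (japanese x powr \<alpha> * cmod ((f x u - f x v) / (u - v))))"

text \<open>
  Test functions: all iterated partial derivatives exist as (totally) differentiable functions,
  which is equivalent to being smooth.
\<close>

primrec iterated_partial :: "'n list \<Rightarrow> (real ^ 'n \<Rightarrow> complex) \<Rightarrow> real ^ 'n \<Rightarrow> complex" where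
  "iterated_partial [] \<psi> = \<psi>"
| "iterated_partial (i # is) \<psi> =
    (\<lambda>x. frechet_derivative (iterated_partial is \<psi>) (at x) (axis i 1))"

definition test_function :: "(real ^ 'n \<Rightarrow> complex) \<Rightarrow> bool" where
  "test_function \<psi> \<longleftrightarrow>
    (\<forall>is. iterated_partial is \<psi> differentiable_on UNIV) \<and> compact (closure {x. \<psi> x \<noteq> 0})"

definition laplacian :: "(real ^ 'n \<Rightarrow> complex) \<Rightarrow> real ^ 'n \<Rightarrow> complex" where
  "laplacian \<psi> x = (\<Sum>i\<in>UNIV. iterated_partial [i, i] \<psi> x)"

text \<open>
  The homogeneous Helmholtz equation in the sense of distributions; by elliptic regularity
  a bounded distributional solution agrees almost everywhere with a smooth classical one.
\<close>

definition helmholtz_solution :: "real \<Rightarrow> (real ^ 'n \<Rightarrow> complex) \<Rightarrow> bool" where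
  "helmholtz_solution k \<phi> \<longleftrightarrow>
    (\<forall>\<psi>. test_function \<psi> \<longrightarrow>
       (LINT x|lebesgue. \<phi> x * (laplacian \<psi> x + of_real (k\<^sup>2) * \<psi> x)) = 0)"

text \<open>The equation is an identity between elements of the space \<^const>\<open>Linf\<close>.\<close>

definition solves_integral_equation ::
    "real \<Rightarrow> (real ^ 'n \<Rightarrow> complex \<Rightarrow> complex) \<Rightarrow> (real ^ 'n \<Rightarrow> complex) \<Rightarrow> (real ^ 'n \<Rightarrow> complex) \<Rightarrow> bool"
  where
  "solves_integral_equation k f \<phi> u \<longleftrightarrow>
    convolution_exists (Phi k) (substitution f u) \<and>
    (AE x in lebesgue. u x = resolvent k (substitution f u) x + \<phi> x)"

end

theory Submission
  imports Defs
begin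

text \<open>
  The hypothesis on the Lipschitz constant forces \<^const>\<open>kappa\<close> to be finite. Testing the supremum
  with the weight \<open>w(y) = \<langle>y\<rangle>\<close> to the power \<open>-\<alpha>\<close>, whose norm is 1, shows that
  \<open>|\<Phi>| * w \<le> \<kappa>\<close> almost everywhere, because \<open>\<tau>(\<alpha>) \<ge> 0\<close>. Hence every
  convolution that occurs converges, no asymptotics of the Hankel function being needed, and
  \<open>u \<mapsto> R(N u) + \<phi>\<close> is a contraction with factor \<open>l \<kappa> < 1\<close> in the supremum norm. What has to
  be known about \<open>\<Phi>\<close> itself is its measurability; the delicate point is integer order, where the
  Bessel function \<open>Y\<close> is a limit in the order.
\<close>

section \<open>Measurability of limits in a real parameter\<close>

text \<open>Existence of the limit is a condition on uncountably many parameters. Continuity in the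
  parameter near \<open>a\<close> reduces the Cauchy criterion to rational parameters, hence to
  countably many measurable conditions. Where it holds, a single sequence computes the
  limit.\<close>

lemma measurable_Lim_at:
  fixes g :: "real \<Rightarrow> 'a \<Rightarrow> 'b::{banach, second_countable_topology}"
  assumes meas [measurable]: "\<And>p. g p \<in> borel_measurable M"
    and cont: "\<And>x. continuous_on {p. 0 < \<bar>p - a\<bar> \<and> \<bar>p - a\<bar> < 1} (\<lambda>p. g p x)"
  shows "(\<lambda>x. Lim (at a) (\<lambda>p. g p x)) \<in> borel_measurable M"
proof -
  define S where "S n = {p. 0 < \<bar>p - a\<bar> \<and> \<bar>p - a\<bar> < 1 / real (Suc n)}" for n :: nat
  \<comment> \<open>The Cauchy criterion over rational parameters says whether the limit exists. Where it does not,
    \<^const>\<open>Lim\<close> has the constant value \<open>THE l. False\<close>.\<close>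
  define P where "P x \<longleftrightarrow> (\<forall>n. \<exists>m. \<forall>p q :: rat. of_rat p \<in> S m \<longrightarrow> of_rat q \<in> S m \<longrightarrow>
      dist (g (of_rat p) x) (g (of_rat q) x) < 1 / real (Suc n))" for x
  have S_ev: "\<forall>\<^sub>F p in at a. p \<in> S n" for n
    unfolding eventually_at by (rule exI[of _ "1 / real (Suc n)"]) (auto simp: S_def dist_real_def)
  have S_open: "open (S n)" for n
  proof -
    have "S n = ball a (1 / real (Suc n)) - {a}"
      by (auto simp: S_def dist_real_def abs_minus_commute)
    thus ?thesis by (simp add: open_delete)
  qed
  have S_cont: "continuous_on (S n) (\<lambda>p. g p x)" for n x
    using cont
  proof (rule continuous_on_subset)
    have "1 / real (Suc n) \<le> 1" by simp
    then show "S n \<subseteq> {p. 0 < \<bar>p - a\<bar> \<and> \<bar>p - a\<bar> < 1}" unfolding S_def by (auto intro: less_le_trans)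
  qed
  have lim_imp_P: "P x" if L: "((\<lambda>p. g p x) \<longlongrightarrow> l) (at a)" for x l
    unfolding P_def
  proof
    fix n
    have "\<forall>\<^sub>F p in at a. dist (g p x) l < 1 / real (Suc n) / 2"
      using L by (rule tendstoD) simp
    then obtain d where d: "d > 0" "\<And>p. p \<noteq> a \<Longrightarrow> dist p a < d \<Longrightarrow> dist (g p x) l < 1 / real (Suc n) / 2"
      unfolding eventually_at by auto
    obtain m where m: "1 / real (Suc m) < d"
      using d(1) nat_approx_posE by blast
    have "dist (g p x) (g q x) < 1 / real (Suc n)" if "p \<in> S m" "q \<in> S m" for p q
    proof -
      have "dist (g p x) l < 1 / real (Suc n) / 2" "dist (g q x) l < 1 / real (Suc n) / 2"
        using that m d(2)[of p] d(2)[of q] by (auto simp: S_def dist_real_def simp del: of_nat_Suc)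
      then have "dist (g p x) l + dist (g q x) l < 1 / real (Suc n)" by linarith
      then show ?thesis using dist_triangle2[of "g p x" "g q x" l] by linarith
    qed
    then show "\<exists>m. \<forall>p q :: rat. of_rat p \<in> S m \<longrightarrow> of_rat q \<in> S m \<longrightarrow>
      dist (g (of_rat p) x) (g (of_rat q) x) < 1 / real (Suc n)" by blast
  qed
  have P_imp_lim: "\<exists>l. ((\<lambda>p. g p x) \<longlongrightarrow> l) (at a)" if "P x" for x
  proof -
    \<comment> \<open>Density transfers the Cauchy estimate from rational to real parameters:
      \<open>S m\<close> is open and \<open>g\<close> is continuous in the parameter there, so a
      nearby rational stays in \<open>S m\<close> and almost preserves the value.\<close>
    have approx: "\<exists>r :: rat. of_rat r \<in> S m \<and> dist (g (of_rat r) x) (g p x) < e"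
      if "p \<in> S m" "e > 0" for p m e
    proof -
      have "isCont (\<lambda>q. g q x) p"
        using S_cont S_open \<open>p \<in> S m\<close> by (meson continuous_on_eq_continuous_at)
      then have "((\<lambda>q. g q x) \<longlongrightarrow> g p x) (nhds p)"
        unfolding isCont_def by (rule tendsto_at_iff_tendsto_nhds[THEN iffD1])
      then have "\<forall>\<^sub>F q in nhds p. dist (g q x) (g p x) < e"
        using \<open>e > 0\<close> by (rule tendstoD)
      moreover have "\<forall>\<^sub>F q in nhds p. q \<in> S m"
        using S_open \<open>p \<in> S m\<close> by (rule eventually_nhds_in_open)
      ultimately have "\<forall>\<^sub>F q in nhds p. q \<in> S m \<and> dist (g q x) (g p x) < e"
        by eventually_elim auto
      then obtain d where d: "d > 0"
        "\<And>q. dist q p < d \<Longrightarrow> q \<in> S m \<and> dist (g q x) (g p x) < e"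
        unfolding eventually_nhds_metric by blast
      obtain r where "p < of_rat r" "of_rat r < p + d"
        using of_rat_dense[of p "p + d"] d(1) by auto
      then show ?thesis
        by (intro exI[of _ r] d(2)) (simp add: dist_real_def)
    qed
    have "cauchy_filter (filtermap (\<lambda>p. g p x) (at a))"
      unfolding cauchy_filter_metric_filtermap
    proof (intro allI impI)
      fix e :: real assume "e > 0"
      then obtain n where n: "1 / real (Suc n) < e / 3"
        using nat_approx_posE[of "e/3"] by auto
      obtain m where m: "\<And>p q :: rat. of_rat p \<in> S m \<Longrightarrow> of_rat q \<in> S m \<Longrightarrow>
          dist (g (of_rat p) x) (g (of_rat q) x) < 1 / real (Suc n)"
        using \<open>P x\<close> unfolding P_def by blast
      have "dist (g p x) (g q x) < e" if pq: "p \<in> S m" "q \<in> S m" for p q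
      proof -
        obtain r s :: rat where r: "of_rat r \<in> S m" "dist (g (of_rat r) x) (g p x) < e / 3"
          and s: "of_rat s \<in> S m" "dist (g (of_rat s) x) (g q x) < e / 3"
          using approx[OF pq(1), of "e/3"] approx[OF pq(2), of "e/3"] \<open>e > 0\<close> by auto
        have "dist (g (of_rat r) x) (g (of_rat s) x) < e / 3"
          using m[OF r(1) s(1)] n by linarith
        then show ?thesis
          using r(2) s(2) dist_triangle[of "g p x" "g q x" "g (of_rat r) x"]
            dist_triangle[of "g (of_rat r) x" "g q x" "g (of_rat s) x"]
          by (simp add: dist_commute)
      qed
      then show "\<exists>P. eventually P (at a) \<and> (\<forall>p q. P p \<and> P q \<longrightarrow> dist (g p x) (g q x) < e)"
        using S_ev by blast
    qed
    then have "\<exists>l. filtermap (\<lambda>p. g p x) (at a) \<le> nhds l"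
      by (rule cauchy_filter_complete_converges[where A = UNIV]) (simp_all add: complete_UNIV filtermap_bot_iff)
    then show ?thesis unfolding filterlim_def by blast
  qed
  \<comment> \<open>The sequence tends to \<open>a\<close> without ever equalling it, so it runs
    inside the punctured filter \<open>at a\<close>.\<close>
  define s where "s n = a + 1 / real (Suc n)" for n
  have s_lim: "filterlim s (at a) sequentially"
  proof (rule filterlim_atI)
    show "s \<longlonglongrightarrow> a"
      unfolding s_def using tendsto_add[OF tendsto_const[of a] LIMSEQ_inverse_real_of_nat]
      by (simp add: inverse_eq_divide)
  qed (auto simp: s_def)
  have "(\<lambda>x. Lim (at a) (\<lambda>p. g p x)) = (\<lambda>x. if P x then lim (\<lambda>n. g (s n) x) else (THE l. False))"
  proof
    fix x
    show "Lim (at a) (\<lambda>p. g p x) = (if P x then lim (\<lambda>n. g (s n) x) else (THE l. False))"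
    proof (cases "P x")
      case True
      then obtain l where l: "((\<lambda>p. g p x) \<longlongrightarrow> l) (at a)" using P_imp_lim by blast
      then have "(\<lambda>n. g (s n) x) \<longlonglongrightarrow> l" using s_lim by (rule filterlim_compose)
      then show ?thesis using True l by (simp add: tendsto_Lim limI)
    next
      case False
      then have "(\<lambda>l. ((\<lambda>p. g p x) \<longlongrightarrow> l) (at a)) = (\<lambda>l. False)" using lim_imp_P by blast
      with False show ?thesis by (simp add: Topological_Spaces.Lim_def)
    qed
  qed
  moreover have "Measurable.pred M P" unfolding P_def by measurable
  ultimately show ?thesis by simp
qed

section \<open>Bessel functions and measurability of the kernel\<close>

text \<open>Continuity gives a bound on a compact interval ending at 2. Beyond 2, the recurrence
  \<open>(z - 1) * rGamma z = rGamma (z - 1)\<close> has a factor \<open>z - 1\<close> above 1, so a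
  unit step to the right cannot increase the absolute value. This yields one constant for all terms
  of the Bessel series and all orders in a bounded interval.\<close>

lemma rGamma_bounded_right:
  fixes B :: real
  obtains C where "\<And>z. z \<ge> B \<Longrightarrow> \<bar>rGamma z\<bar> \<le> C"
proof -
  have "bounded (rGamma ` {min B 1..2})"
    by (intro compact_imp_bounded compact_continuous_image continuous_on_rGamma) auto
  then obtain C where C: "\<And>z. z \<in> {min B 1..2} \<Longrightarrow> \<bar>rGamma z\<bar> \<le> C"
    unfolding bounded_iff by (metis imageI real_norm_def)
  \<comment> \<open>The left end \<open>min B 1\<close> is at most 1, so for \<open>z > 2\<close>
    the shifted point \<open>z - 1\<close> stays in the range of the induction.\<close>
  have "\<bar>rGamma z\<bar> \<le> C" if "z \<ge> min B 1" "z \<le> 2 + real n" for z n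
    using that
  proof (induction n arbitrary: z)
    case (Suc n)
    show ?case
    proof (cases "z \<le> 2")
      case False
      then have "\<bar>rGamma (z - 1)\<bar> \<le> C" using Suc.prems by (intro Suc.IH) auto
      moreover have "(z - 1) * rGamma z = rGamma (z - 1)"
        using rGamma_plus1[of "z - 1"] by simp
      moreover have "1 * \<bar>rGamma z\<bar> \<le> \<bar>z - 1\<bar> * \<bar>rGamma z\<bar>"
        using False by (intro mult_right_mono) auto
      ultimately show ?thesis by (simp add: abs_mult [symmetric])
    qed (use C Suc.prems in auto)
  qed (use C in auto)
  then have "\<bar>rGamma z\<bar> \<le> C" if "z \<ge> B" for z
    using real_arch_simple[of "z - 2"] that by (metis min.coboundedI1 diff_le_eq add.commute)
  then show thesis by (rule that)
qed

text \<open>The defining series converges uniformly for orders in a bounded open interval, and such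
  intervals cover the line.\<close>

lemma continuous_bessel_J_order: "continuous_on UNIV (\<lambda>\<mu>. bessel_J \<mu> r)"
proof (cases "r = 0")
  \<comment> \<open>Since \<open>0 powr a = 0\<close> for every exponent, all terms of the series
    vanish.\<close>
  case True then show ?thesis by (simp add: bessel_J_def)
next
  case False
  define L where "L = ln (r / 2)"
  define t where "t m \<mu> = (- 1) ^ m / fact m * rGamma (real m + \<mu> + 1) * (r / 2) powr (2 * real m + \<mu>)" for m \<mu>
  have J: "bessel_J \<mu> r = (\<Sum>m. t m \<mu>)" for \<mu> by (simp add: bessel_J_def t_def)
  have "continuous_on {-B<..<B} (\<lambda>\<mu>. \<Sum>m. t m \<mu>)" for B
  proof -
    obtain C where C: "\<And>z. z \<ge> - B \<Longrightarrow> \<bar>rGamma z\<bar> \<le> C"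
      using rGamma_bounded_right by blast
    show ?thesis
    proof (rule uniform_limit_theorem[OF _ Weierstrass_m_test])
      \<comment> \<open>The majorant comes from writing \<open>(r / 2) powr (2 * m + \<mu>)\<close>
        as \<open>exp (2 * L) ^ m * exp (\<mu> * L)\<close>. The last factor is at most
        \<open>exp (B * \<bar>L\<bar>)\<close> and \<open>rGamma\<close> is at most
        \<open>C\<close>, which leaves an exponential series.\<close>
      show "summable (\<lambda>m. C * exp (B * \<bar>L\<bar>) * (exp (2 * L) ^ m /\<^sub>R fact m))"
        by (intro summable_mult summable_exp_generic)
      show "norm (t m \<mu>) \<le> C * exp (B * \<bar>L\<bar>) * (exp (2 * L) ^ m /\<^sub>R fact m)"
        if "\<mu> \<in> {-B<..<B}" for m \<mu>
      proof -
        have "\<bar>rGamma (real m + \<mu> + 1)\<bar> \<le> C" using that by (intro C) auto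
        moreover have "\<mu> * L \<le> B * \<bar>L\<bar>"
        proof -
          have "\<mu> * L \<le> \<bar>\<mu>\<bar> * \<bar>L\<bar>" by (metis abs_ge_self abs_mult)
          also have "\<dots> \<le> B * \<bar>L\<bar>" using that by (intro mult_right_mono) auto
          finally show ?thesis .
        qed
        ultimately have "\<bar>rGamma (real m + \<mu> + 1)\<bar> * exp (\<mu> * L) \<le> C * exp (B * \<bar>L\<bar>)"
          by (intro mult_mono) auto
        then have "(\<bar>rGamma (real m + \<mu> + 1)\<bar> * exp (\<mu> * L)) * (exp (2 * L) ^ m /\<^sub>R fact m)
            \<le> C * exp (B * \<bar>L\<bar>) * (exp (2 * L) ^ m /\<^sub>R fact m)"
          by (rule mult_right_mono) simp
        also have "(\<bar>rGamma (real m + \<mu> + 1)\<bar> * exp (\<mu> * L)) * (exp (2 * L) ^ m /\<^sub>R fact m) = norm (t m \<mu>)"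
          using False
          by (simp add: t_def abs_mult powr_def L_def exp_of_nat_mult [symmetric] field_simps
              exp_add power_abs)
        finally show ?thesis .
      qed
      show "\<forall>\<^sub>F n in sequentially. continuous_on {-B<..<B} (\<lambda>\<mu>. \<Sum>m<n. t m \<mu>)"
        unfolding t_def using False by (intro always_eventually allI continuous_intros
            continuous_on_compose2[OF continuous_on_rGamma[of UNIV]]) auto
    qed simp
  qed
  then have "continuous_on (\<Union>B\<in>UNIV. {-B<..<B}) (\<lambda>\<mu>. \<Sum>m. t m \<mu>)"
    by (intro continuous_on_open_UN) auto
  moreover have "(\<Union>B\<in>UNIV. {-B<..<B}) = (UNIV :: real set)"
  proof -
    have "x \<in> {-(\<bar>x\<bar> + 1)<..<\<bar>x\<bar> + 1}" for x :: real by auto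
    then show ?thesis by blast
  qed
  ultimately show ?thesis by (simp add: J)
qed

lemma measurable_bessel_J [measurable]: "bessel_J \<nu> \<in> borel_measurable borel"
  unfolding bessel_J_def [abs_def] by measurable

text \<open>At an integer order \<open>measurable_Lim_at\<close> applies with radius 1, the spacing
  of the integers: the zeros of \<open>sin (\<mu> * pi)\<close> are the integers, so the quotient is
  continuous in the order on the punctured neighbourhood.\<close>

lemma measurable_bessel_Y [measurable]: "bessel_Y \<nu> \<in> borel_measurable borel"
proof (cases "\<nu> \<in> \<int>")
  case True
  have "(\<lambda>r. Lim (at \<nu>) (\<lambda>\<mu>. bessel_Y_quotient \<mu> r)) \<in> borel_measurable borel"
  proof (rule measurable_Lim_at)
    fix r
    have "continuous_on UNIV (\<lambda>\<mu>. bessel_J (- \<mu>) r)"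
      by (rule continuous_on_compose2[OF continuous_bessel_J_order]) (auto intro: continuous_intros)
    moreover have "sin (\<mu> * pi) \<noteq> 0" if "0 < \<bar>\<mu> - \<nu>\<bar>" "\<bar>\<mu> - \<nu>\<bar> < 1" for \<mu>
    proof
      assume "sin (\<mu> * pi) = 0"
      then obtain i where "\<mu> * pi = of_int i * pi" by (auto simp: sin_zero_iff_int2)
      then have "\<mu> = of_int i" by simp
      with that True show False by (auto elim!: Ints_cases) 
    qed
    ultimately show "continuous_on {\<mu>. 0 < \<bar>\<mu> - \<nu>\<bar> \<and> \<bar>\<mu> - \<nu>\<bar> < 1} (\<lambda>\<mu>. bessel_Y_quotient \<mu> r)"
      unfolding bessel_Y_quotient_def
      by (intro continuous_on_divide continuous_on_diff continuous_on_mult continuous_on_cos continuous_on_sin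
          continuous_on_id continuous_on_const ballI
          continuous_on_subset[OF continuous_bessel_J_order subset_UNIV]) 
         (auto intro: continuous_on_subset)
  qed (simp add: bessel_Y_quotient_def)
  with True show ?thesis by (simp add: bessel_Y_def [abs_def])
next
  case False
  then show ?thesis by (simp add: bessel_Y_def [abs_def] bessel_Y_quotient_def)
qed

lemma measurable_Phi [measurable]: "Phi k \<in> borel_measurable borel"
  unfolding Phi_def [abs_def] hankel1_def Complex_eq by measurable

section \<open>Banach's principle for bounded measurable functions\<close>

text \<open>The Picard iterates from 0 have geometrically decaying increments, so they converge
  uniformly, which preserves boundedness and measurability. Working with functions and bounds valid
  everywhere replaces the quotient by null functions.\<close>

lemma contraction_fixed_point_measurable:
  fixes T :: "('a \<Rightarrow> 'b::{banach, second_countable_topology}) \<Rightarrow> 'a \<Rightarrow> 'b"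
  assumes meas: "\<And>u. u \<in> borel_measurable M \<Longrightarrow> bounded (range u) \<Longrightarrow> T u \<in> borel_measurable M"
    and bdd: "\<And>u. u \<in> borel_measurable M \<Longrightarrow> bounded (range u) \<Longrightarrow> bounded (range (T u))"
    and contr: "\<And>u v C x. u \<in> borel_measurable M \<Longrightarrow> bounded (range u) \<Longrightarrow>
        v \<in> borel_measurable M \<Longrightarrow> bounded (range v) \<Longrightarrow>
        (\<And>y. dist (u y) (v y) \<le> C) \<Longrightarrow> dist (T u x) (T v x) \<le> q * C"
    and q: "0 \<le> q" "q < 1"
  obtains u where "u \<in> borel_measurable M" "bounded (range u)" "T u = u"
proof -
  define u where "u n = (T ^^ n) (\<lambda>_. 0)" for n
  have u_Suc: "u (Suc n) = T (u n)" for n by (simp add: u_def)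
  have u: "u n \<in> borel_measurable M \<and> bounded (range (u n))" for n
  proof (induction n)
    case 0 show ?case by (simp add: u_def)
  next
    case (Suc n) then show ?case using meas bdd by (simp add: u_Suc)
  qed
  \<comment> \<open>Since \<open>u 0\<close> is zero, \<open>C\<close> bounds the first increment
    and starts the geometric estimate.\<close>
  obtain C where C: "\<And>x. norm (u 1 x) \<le> C"
    using u[of 1] unfolding bounded_iff by auto
  have diff: "dist (u (Suc n) x) (u n x) \<le> C * q ^ n" for n x
  proof (induction n arbitrary: x)
    case 0 then show ?case using C by (simp add: u_def)
  next
    case (Suc n)
    have "dist (T (u (Suc n)) x) (T (u n) x) \<le> q * (C * q ^ n)"
      by (rule contr) (use u Suc.IH in auto)
    then show ?case by (simp add: u_Suc mult_ac)
  qed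
  define U where "U x = (\<Sum>i. u (Suc i) x - u i x)" for x
  have "uniform_limit UNIV (\<lambda>n x. \<Sum>i<n. u (Suc i) x - u i x) U sequentially"
    unfolding U_def
  proof (rule Weierstrass_m_test)
    show "norm (u (Suc n) x - u n x) \<le> C * q ^ n" for n x using diff by (simp add: dist_norm)
    show "summable (\<lambda>n. C * q ^ n)" using q by (intro summable_mult summable_geometric) auto
  qed
  moreover have "(\<Sum>i<n. u (Suc i) x - u i x) = u n x" for n x
    using sum_lessThan_telescope[of "\<lambda>i. u i x" n] by (simp add: u_def)
  ultimately have unif: "uniform_limit UNIV u U sequentially" by simp
  then have lim: "(\<lambda>n. u n x) \<longlonglongrightarrow> U x" for x by (rule tendsto_uniform_limitI) simp
  have U_meas: "U \<in> borel_measurable M"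
    by (rule borel_measurable_LIMSEQ_metric[of u]) (use u lim in auto)
  have close: "\<forall>\<^sub>F n in sequentially. \<forall>x. dist (u n x) (U x) < e" if "e > 0" for e
    using uniform_limitD[OF unif that] by simp
  have U_bdd: "bounded (range U)"
  proof -
    obtain n where n: "\<And>x. dist (u n x) (U x) < 1"
      using eventually_happens'[OF _ close[of 1]] by auto
    obtain B where B: "\<And>x. norm (u n x) \<le> B" using u[of n] unfolding bounded_iff by auto
    have "norm (U x) \<le> B + 1" for x
      using B[of x] n[of x] norm_triangle_sub[of "U x" "u n x"]
      by (simp add: dist_norm norm_minus_commute)
    then show ?thesis unfolding bounded_iff by auto
  qed
  \<comment> \<open>Both sides are limits of the shifted iterates: the contraction estimate carries
    the uniform convergence of \<open>u n\<close> to \<open>U\<close> over to \<open>T (u n)\<close>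
    and \<open>T U\<close>.\<close>
  have "T U x = U x" for x
  proof (rule LIMSEQ_unique)
    show "(\<lambda>n. u (Suc n) x) \<longlonglongrightarrow> U x" using lim by (rule LIMSEQ_Suc)
    show "(\<lambda>n. u (Suc n) x) \<longlonglongrightarrow> T U x"
    proof (rule tendstoI)
      fix e :: real assume "e > 0"
      show "\<forall>\<^sub>F n in sequentially. dist (u (Suc n) x) (T U x) < e"
        using close[OF \<open>e > 0\<close>]
      proof eventually_elim
        case (elim n)
        have "dist (T (u n) x) (T U x) \<le> q * e"
          by (rule contr) (use u U_meas U_bdd elim in \<open>auto intro: less_imp_le\<close>)
        also have "\<dots> < e" using q \<open>e > 0\<close> by simp
        finally show ?case by (simp add: u_Suc)
      qed
    qed
  qed
  then show thesis using that U_meas U_bdd by blast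
qed

section \<open>Convolutions over Lebesgue measure\<close>

lemma measurable_lebesgue_borel:
  fixes f :: "'a::euclidean_space \<Rightarrow> 'b::topological_space"
  shows "f \<in> borel_measurable borel \<Longrightarrow> f \<in> borel_measurable lebesgue"
  by (rule measurable_completion) simp

text \<open>Replacing \<open>w\<close> by a Borel function equal to it almost everywhere changes the
  integral for no \<open>x\<close>. The new integrand is jointly Borel in \<open>x\<close> and
  \<open>y\<close>, so its integral over \<open>y\<close> depends measurably on
  \<open>x\<close>.\<close>

lemma measurable_convolution:
  fixes g w :: "real ^ 'n \<Rightarrow> complex"
  assumes g [measurable]: "g \<in> borel_measurable borel" and w [measurable]: "w \<in> borel_measurable lebesgue"
  shows "convolution g w \<in> borel_measurable borel"
proof -
  have "(\<lambda>x. Re (w x)) \<in> borel_measurable lebesgue" "(\<lambda>x. Im (w x)) \<in> borel_measurable lebesgue"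
    by measurable
  from this[THEN completion_ex_borel_measurable_real]
  obtain a b where [measurable]: "a \<in> borel_measurable lborel" "b \<in> borel_measurable lborel"
    and a: "AE x in lborel. Re (w x) = a x" and b: "AE x in lborel. Im (w x) = b x"
    by blast
  define w' where "w' y = complex_of_real (a y) + \<i> * complex_of_real (b y)" for y
  have w'_meas [measurable]: "w' \<in> borel_measurable borel"
    unfolding w'_def by measurable
  have "AE y in lborel. w y = w' y"
    using a b by eventually_elim (simp add: w'_def complex_eq_iff)
  then have ae: "AE y in lebesgue. w y = w' y" by (rule AE_completion)
  have eq: "convolution g w x = (LINT y|lborel. g (x - y) * w' y)" for x
  proof -
    have gx [measurable]: "(\<lambda>y. g (x - y)) \<in> borel_measurable lebesgue"
      by (rule measurable_lebesgue_borel) measurable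
    have [measurable]: "w' \<in> borel_measurable lebesgue"
      by (rule measurable_lebesgue_borel) measurable
    have "convolution g w x = (LINT y|lebesgue. g (x - y) * w' y)"
      unfolding convolution_def
      by (rule integral_cong_AE) (use ae in \<open>auto elim: eventually_mono\<close>)
    also have "\<dots> = (LINT y|lborel. g (x - y) * w' y)"
      by (rule integral_completion) measurable
    finally show ?thesis .
  qed
  have "(\<lambda>x. LINT y|lborel. g (x - y) * w' y) \<in> borel_measurable borel"
    by measurable
  then show ?thesis by (simp add: eq [abs_def])
qed

text \<open>Domination by \<open>C * W\<close> lets one kernel integral at \<open>x\<close> serve
  all functions with the same decay. It is applied with \<open>W\<close> a negative power of
  \<open>japanese\<close> and \<open>K\<close> the value of \<open>kappa\<close>.\<close>

lemma weighted_convolution_bound: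
  fixes g w :: "real ^ 'n \<Rightarrow> complex"
  assumes g [measurable]: "g \<in> borel_measurable borel" and w [measurable]: "w \<in> borel_measurable lebesgue"
    and int: "integrable lebesgue (\<lambda>y. cmod (g (x - y)) * W y)"
    and K: "(LINT y|lebesgue. cmod (g (x - y)) * W y) \<le> K"
    and wW: "AE y in lebesgue. cmod (w y) \<le> C * W y" and "C \<ge> 0"
  shows "integrable lebesgue (\<lambda>y. g (x - y) * w y)" and "cmod (convolution g w x) \<le> C * K"
proof -
  have [measurable]: "(\<lambda>y. g (x - y)) \<in> borel_measurable lebesgue"
    by (rule measurable_lebesgue_borel) measurable
  have int': "integrable lebesgue (\<lambda>y. C * (cmod (g (x - y)) * W y))" using int by simp
  have ae: "AE y in lebesgue. cmod (g (x - y) * w y) \<le> C * (cmod (g (x - y)) * W y)"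
    using wW
  proof eventually_elim
    case (elim y)
    then have "cmod (g (x - y)) * cmod (w y) \<le> cmod (g (x - y)) * (C * W y)"
      by (rule mult_left_mono) simp
    then show ?case by (simp add: norm_mult mult_ac)
  qed
  show int_gw: "integrable lebesgue (\<lambda>y. g (x - y) * w y)"
    by (rule Bochner_Integration.integrable_bound[OF int'])
       (use ae in \<open>auto elim!: eventually_mono intro: order_trans[OF _ abs_ge_self]\<close>)
  have "cmod (convolution g w x) \<le> (LINT y|lebesgue. cmod (g (x - y) * w y))"
    unfolding convolution_def by (rule integral_norm_bound)
  also have "\<dots> \<le> (LINT y|lebesgue. C * (cmod (g (x - y)) * W y))"
    by (intro integral_mono_AE int' integrable_norm int_gw ae)
  also have "\<dots> \<le> C * K" using K \<open>C \<ge> 0\<close> by (simp add: mult_left_mono)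
  finally show "cmod (convolution g w x) \<le> C * K" .
qed

lemma japanese_ge_1: "japanese x \<ge> 1"
  by (simp add: japanese_def)

lemma measurable_japanese [measurable]: "japanese \<in> borel_measurable borel"
  unfolding japanese_def [abs_def] by measurable

section \<open>From the operator norm to a kernel bound\<close>

text \<open>A divergent convolution would contribute the value infinity to the supremum, so
  finiteness of \<open>kappa\<close> gives integrability together with the bound.\<close>

lemma kappa_kernel_bound:
  fixes k \<alpha> :: real
  assumes kappa: "kappa TYPE('n::finite) k \<alpha> = ennreal K" and "K \<ge> 0" and tau: "tau TYPE('n) \<alpha> \<ge> 0"
  shows "AE x :: real ^ 'n in lebesgue.
    integrable lebesgue (\<lambda>y. cmod (Phi k (x - y)) * japanese y powr (- \<alpha>)) \<and>
    (LINT y|lebesgue. cmod (Phi k (x - y)) * japanese y powr (- \<alpha>)) \<le> K"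
proof -
  define w :: "real ^ 'n \<Rightarrow> complex" where "w x = of_real (japanese x powr (- \<alpha>))" for x
  define g :: "real ^ 'n \<Rightarrow> complex" where "g x = of_real (cmod (Phi k x))" for x
  have "w \<in> borel_measurable lebesgue"
    unfolding w_def by (rule measurable_lebesgue_borel) measurable
  moreover have norm_w: "wLinf_norm \<alpha> w = 1"
  proof -
    have "of_real (japanese x powr \<alpha>) * w x = 1" for x
      using japanese_ge_1[of x] by (simp add: w_def powr_minus flip: of_real_mult)
    \<comment> \<open>Positive measure of the space makes the essential supremum of the constant 1
      equal to 1.\<close>
    moreover have "emeasure lebesgue (space lebesgue :: (real ^ 'n) set) \<noteq> 0" by simp
    ultimately show ?thesis
      unfolding wLinf_norm_def Linf_norm_def by (simp add: esssup_const)
  qed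
  ultimately have "w \<in> {w. w \<in> wLinf \<alpha> \<and> wLinf_norm \<alpha> w = 1}" by (simp add: wLinf_def)
  then have le: "(if convolution_exists g w then wLinf_norm (tau TYPE('n) \<alpha>) (convolution g w) else \<infinity>) \<le> ennreal K"
    unfolding kappa[symmetric] kappa_def Let_def g_def [abs_def] by (rule SUP_upper)
  have ex: "convolution_exists g w"
    using le by (auto split: if_splits simp: top_unique)
  have "wLinf_norm (tau TYPE('n) \<alpha>) (convolution g w) \<le> ennreal K" using le ex by simp
  then have "AE x in lebesgue.
      ennreal (cmod (of_real (japanese x powr tau TYPE('n) \<alpha>) * convolution g w x)) \<le> ennreal K"
    unfolding wLinf_norm_def Linf_norm_def
    using esssup_AE[of "\<lambda>x. ennreal (cmod (of_real (japanese x powr tau TYPE('n) \<alpha>) * convolution g w x))" lebesgue]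
    by (auto elim!: eventually_mono)
  with ex[unfolded convolution_exists_def] show ?thesis
  proof eventually_elim
    case (elim x)
    have eq: "g (x - y) * w y = of_real (cmod (Phi k (x - y)) * japanese y powr (- \<alpha>))" for y
      by (simp add: g_def w_def)
    have int: "integrable lebesgue (\<lambda>y. cmod (Phi k (x - y)) * japanese y powr (- \<alpha>))"
      using integrable_Re[OF elim(1)] unfolding eq by simp
    have conv: "convolution g w x = of_real (LINT y|lebesgue. cmod (Phi k (x - y)) * japanese y powr (- \<alpha>))"
      unfolding convolution_def eq by (rule integral_complex_of_real)
    have "1 * cmod (convolution g w x) \<le> japanese x powr tau TYPE('n) \<alpha> * cmod (convolution g w x)"
      using japanese_ge_1[of x] tau by (intro mult_right_mono ge_one_powr_ge_zero) auto
    also have "\<dots> \<le> K" using elim(2) \<open>K \<ge> 0\<close> by (simp add: norm_mult ennreal_le_iff)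
    finally show ?case using int unfolding conv by simp
  qed
qed

lemma measurable_substitution:
  fixes f :: "real ^ 'n \<Rightarrow> complex \<Rightarrow> complex"
  assumes f: "continuous_on UNIV (\<lambda>(x, u). f x u)" and u [measurable]: "u \<in> borel_measurable lebesgue"
  shows "substitution f u \<in> borel_measurable lebesgue"
proof -
  have "(\<lambda>(x, u). f x u) \<in> borel_measurable (borel \<Otimes>\<^sub>M borel)"
    using borel_measurable_continuous_onI[OF f] by (simp add: borel_prod)
  moreover have "(\<lambda>x. (x, u x)) \<in> lebesgue \<rightarrow>\<^sub>M borel \<Otimes>\<^sub>M borel"
    by (intro measurable_Pair u measurable_lebesgue_borel) simp
  ultimately have "(\<lambda>x. (\<lambda>(x, u). f x u) (x, u x)) \<in> borel_measurable lebesgue"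
    by (rule measurable_compose[rotated])
  then show ?thesis by (simp add: substitution_def [abs_def])
qed

lemma Linf_AE_bounded:
  assumes "w \<in> Linf"
  obtains B where "B \<ge> 0" "AE x in lebesgue. cmod (w x) \<le> B"
proof -
  obtain B where B: "Linf_norm w = ennreal B" "B \<ge> 0"
    using assms by (cases "Linf_norm w") (auto simp: Linf_def)
  have "AE x in lebesgue. ennreal (cmod (w x)) \<le> Linf_norm w"
    unfolding Linf_norm_def by (rule esssup_AE)
  then have "AE x in lebesgue. cmod (w x) \<le> B" using B by (auto elim!: eventually_mono)
  with B(2) show thesis by (rule that)
qed

section \<open>Existence and uniqueness for the integral equation\<close>

theorem theorem6p3:
  fixes k \<alpha> :: real
    and f :: "real ^ 'n \<Rightarrow> complex \<Rightarrow> complex"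
    and \<phi> :: "real ^ 'n \<Rightarrow> complex"
  assumes "CARD('n) \<ge> 3"
    and "k > 0"
    and "\<alpha> > (real CARD('n) + 1) / 2"
    and "continuous_on UNIV (\<lambda>(x, u). f x u)"
    and "\<And>M::real. M > 0 \<Longrightarrow>
      (SUP (x, u) \<in> UNIV \<times> {u. cmod u \<le> M}. ennreal (japanese x powr \<alpha> * cmod (f x u))) < \<infinity>"
    and "lipschitz_sup \<alpha> f < 1 / kappa TYPE('n) k \<alpha>"
    and "\<phi> \<in> Linf"
    and "helmholtz_solution k \<phi>"
  shows "\<exists>u \<in> Linf. solves_integral_equation k f \<phi> u \<and>
           (\<forall>v \<in> Linf. solves_integral_equation k f \<phi> v \<longrightarrow> (AE x in lebesgue. v x = u x))"
proof -
  let ?R = "\<lambda>u. convolution (Phi k) (substitution f u)"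
  note subst_meas = measurable_substitution[OF assms(4)]
  have \<phi>_meas [measurable]: "\<phi> \<in> borel_measurable lebesgue" using assms(7) by (simp add: Linf_def)
  \<comment> \<open>In \<open>ennreal\<close>, \<open>1 / \<infinity>\<close> is 0, and nothing lies
    strictly below 0.\<close>
  have "kappa TYPE('n) k \<alpha> \<noteq> \<infinity>"
  proof
    assume "kappa TYPE('n) k \<alpha> = \<infinity>"
    with assms(6) show False by simp
  qed
  then obtain K where K: "kappa TYPE('n) k \<alpha> = ennreal K" "K \<ge> 0"
    by (cases "kappa TYPE('n) k \<alpha>") auto
  have "lipschitz_sup \<alpha> f \<noteq> \<infinity>" using assms(6) by auto
  then obtain l where l: "lipschitz_sup \<alpha> f = ennreal l" "l \<ge> 0"
    by (cases "lipschitz_sup \<alpha> f") auto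
  have lK: "l * K < 1"
  \<comment> \<open>For \<open>K = 0\<close> the quotient \<open>1 / kappa\<close> is infinite; the
    product \<open>l * K\<close> is then simply 0.\<close>
  proof (cases "K = 0")
    case False
    then have "ennreal l < ennreal (1 / K)"
      using assms(6) K l(1) by (simp add: divide_ennreal flip: ennreal_1)
    then show ?thesis using False K(2) l(2) by (simp add: ennreal_less_iff field_simps)
  qed simp

  have weight: "c * japanese x powr (- \<alpha>) = c / japanese x powr \<alpha>" for c and x :: "real ^ 'n"
    by (simp add: powr_minus divide_inverse)
  have weight_pos: "japanese x powr \<alpha> > 0" for x :: "real ^ 'n"
    using japanese_ge_1[of x] by simp
  have lip: "cmod (f x u - f x v) \<le> l * cmod (u - v) * japanese x powr (- \<alpha>)" for x u v
  proof (cases "u = v")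
    case False
    then have "ennreal (japanese x powr \<alpha> * cmod ((f x u - f x v) / (u - v))) \<le> ennreal l"
      unfolding l(1)[symmetric] lipschitz_sup_def
      by (intro SUP_upper2[where i = "(x, u, v)"]) auto
    then have "japanese x powr \<alpha> * cmod ((f x u - f x v) / (u - v)) \<le> l"
      using l(2) by (simp add: ennreal_le_iff)
    then show ?thesis
      unfolding weight using False weight_pos[of x] by (simp add: norm_divide field_simps)
  qed simp
  have growth: "\<exists>C\<ge>0. \<forall>x u. cmod u \<le> B \<longrightarrow> cmod (f x u) \<le> C * japanese x powr (- \<alpha>)" for B
  proof -
    \<comment> \<open>The growth hypothesis concerns positive radii, whereas \<open>B\<close> is
      arbitrary.\<close>
    have "B \<le> max B 1" "max B 1 > 0" by auto
    define S where "S = (SUP (x, u) \<in> UNIV \<times> {u. cmod u \<le> max B 1}. ennreal (japanese x powr \<alpha> * cmod (f x u)))"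
    have "S < \<infinity>" unfolding S_def using \<open>max B 1 > 0\<close> by (rule assms(5))
    then obtain C where C: "S = ennreal C" "C \<ge> 0" by (cases S) auto
    have "cmod (f x u) \<le> C * japanese x powr (- \<alpha>)" if "cmod u \<le> B" for x u
    proof -
      have "ennreal (japanese x powr \<alpha> * cmod (f x u)) \<le> ennreal C"
        unfolding C(1)[symmetric] S_def
        by (intro SUP_upper2[where i = "(x, u)"]) (use that in auto)
      then show ?thesis
        unfolding weight using C(2) weight_pos[of x] by (simp add: ennreal_le_iff field_simps)
    qed
    with C(2) show ?thesis by blast
  qed

  have tau: "tau TYPE('n) \<alpha> \<ge> 0"
    using assms(1,3) by (simp add: tau_def)
  obtain B\<phi> where B\<phi>: "AE x in lebesgue. cmod (\<phi> x) \<le> B\<phi>" "B\<phi> \<ge> 0"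
    using Linf_AE_bounded[OF assms(7)] by blast
  \<comment> \<open>These conditions do not involve \<open>u\<close>. One null set \<open>N\<close>
    therefore serves all densities at once, which a map on a whole function space requires.\<close>
  define good where "good x \<longleftrightarrow> cmod (\<phi> x) \<le> B\<phi> \<and>
      integrable lebesgue (\<lambda>y. cmod (Phi k (x - y)) * japanese y powr (- \<alpha>)) \<and>
      (LINT y|lebesgue. cmod (Phi k (x - y)) * japanese y powr (- \<alpha>)) \<le> K" for x
  have "AE x in lebesgue. good x"
    unfolding good_def using B\<phi>(1) kappa_kernel_bound[OF K tau] by eventually_elim simp
  then obtain N where N: "N \<in> null_sets lebesgue" "\<And>x. x \<notin> N \<Longrightarrow> good x"
    unfolding eventually_ae_filter by auto
  have AE_N: "AE x in lebesgue. x \<notin> N" by (rule AE_not_in[OF N(1)])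

  have R_bound: "integrable lebesgue (\<lambda>y. Phi k (x - y) * w y)"
      "cmod (convolution (Phi k) w x) \<le> C * K"
    if "x \<notin> N" "w \<in> borel_measurable lebesgue" "C \<ge> 0"
      "AE y in lebesgue. cmod (w y) \<le> C * japanese y powr (- \<alpha>)" for x w C
    using weighted_convolution_bound[of "Phi k" w x "\<lambda>y. japanese y powr (- \<alpha>)" K C]
      N(2)[OF that(1)] that(2-4) unfolding good_def by auto
  have subst_AE: "\<exists>C\<ge>0. AE y in lebesgue. cmod (substitution f u y) \<le> C * japanese y powr (- \<alpha>)"
    if bound: "AE y in lebesgue. cmod (u y) \<le> B" for u B
  proof -
    obtain C where "C \<ge> 0" "\<forall>x u. cmod u \<le> B \<longrightarrow> cmod (f x u) \<le> C * japanese x powr (- \<alpha>)"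
      using growth by blast
    then show ?thesis
      using bound by (intro exI[of _ C]) (auto simp: substitution_def elim!: eventually_mono)
  qed
  have R_int: "integrable lebesgue (\<lambda>y. Phi k (x - y) * substitution f u y)"
    if "x \<notin> N" "u \<in> borel_measurable lebesgue" "AE y in lebesgue. cmod (u y) \<le> B" for x u B
    using subst_AE[OF that(3)] R_bound(1)[OF that(1) subst_meas[OF that(2)]] by blast
  have R_contr: "cmod (?R u x - ?R v x) \<le> l * K * D"
    if x: "x \<notin> N" and u: "u \<in> borel_measurable lebesgue" "AE y in lebesgue. cmod (u y) \<le> B"
      and v: "v \<in> borel_measurable lebesgue" "AE y in lebesgue. cmod (v y) \<le> B'"
      and D: "AE y in lebesgue. cmod (u y - v y) \<le> D" "D \<ge> 0" for x u v B B' D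
  proof -
    \<comment> \<open>Integrability of both terms permits subtracting the integrals. The Lipschitz
      condition gives \<open>?w\<close> the decay constant \<open>l * D\<close>, and the kernel
      bound contributes the factor \<open>K\<close>.\<close>
    let ?w = "\<lambda>y. substitution f u y - substitution f v y"
    have "?R u x - ?R v x = convolution (Phi k) ?w x"
      using R_int[OF x u] R_int[OF x v]
      by (simp add: convolution_def right_diff_distrib)
    moreover have "AE y in lebesgue. cmod (?w y) \<le> (l * D) * japanese y powr (- \<alpha>)"
      using D(1)
    proof eventually_elim
      case (elim y)
      then have "l * cmod (u y - v y) * japanese y powr (- \<alpha>) \<le> l * D * japanese y powr (- \<alpha>)"
        using l(2) by (intro mult_right_mono mult_left_mono) auto
      then show ?case using lip[of y "u y" "v y"] by (simp add: substitution_def)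
    qed
    moreover have "?w \<in> borel_measurable lebesgue"
      using subst_meas[OF u(1)] subst_meas[OF v(1)] by measurable
    ultimately show ?thesis
      using R_bound(2)[OF x, of ?w "l * D"] l(2) D(2) by (simp add: mult_ac)
  qed

  \<comment> \<open>The bounds hold only off the null set \<open>N\<close>; with \<open>T u = 0\<close> there, they hold everywhere and the
    iteration takes place in the space of bounded measurable functions.\<close>
  define T where "T u x = (if x \<in> N then 0 else ?R u x + \<phi> x)" for u x
  obtain u where u: "u \<in> borel_measurable lebesgue" "bounded (range u)" "T u = u"
  proof (rule contraction_fixed_point_measurable[of lebesgue T "l * K"])
    show "0 \<le> l * K" "l * K < 1" using l(2) K(2) lK by auto
    fix u :: "real ^ 'n \<Rightarrow> complex" assume u: "u \<in> borel_measurable lebesgue" "bounded (range u)"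
    then obtain B where B: "\<And>y. cmod (u y) \<le> B" unfolding bounded_iff by auto
    have [measurable]: "?R u \<in> borel_measurable lebesgue" "N \<in> sets lebesgue"
      using measurable_convolution[OF measurable_Phi subst_meas[OF u(1)]] measurable_lebesgue_borel N(1)
      by auto
    show "T u \<in> borel_measurable lebesgue" unfolding T_def [abs_def] by measurable
    obtain C where C: "C \<ge> 0" "AE y in lebesgue. cmod (substitution f u y) \<le> C * japanese y powr (- \<alpha>)"
      using subst_AE[of u B] B by auto
    have "cmod (T u x) \<le> C * K + B\<phi>" for x
    proof (cases "x \<in> N")
      case True then show ?thesis using C(1) K(2) B\<phi>(2) by (simp add: T_def)
    next
      case False
      have "cmod (?R u x) \<le> C * K" by (rule R_bound(2)[OF False subst_meas[OF u(1)] C])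
      moreover have "cmod (\<phi> x) \<le> B\<phi>" using N(2)[OF False] by (simp add: good_def)
      ultimately show ?thesis using False norm_triangle_mono by (simp add: T_def)
    qed
    then show "bounded (range (T u))" unfolding bounded_iff by auto
    fix v :: "real ^ 'n \<Rightarrow> complex" and D x
    assume v: "v \<in> borel_measurable lebesgue" "bounded (range v)"
      and D: "\<And>y. dist (u y) (v y) \<le> D"
    then obtain B' where B': "\<And>y. cmod (v y) \<le> B'" unfolding bounded_iff by auto
    have "D \<ge> 0" using D[of 0] zero_le_dist order_trans by blast
    show "dist (T u x) (T v x) \<le> l * K * D"
    proof (cases "x \<in> N")
      case True then show ?thesis using l(2) K(2) \<open>D \<ge> 0\<close> by (simp add: T_def)
    next
      case False
      have "cmod (?R u x - ?R v x) \<le> l * K * D"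
        by (rule R_contr[OF False u(1) _ v(1), of B B']) (use B B' D \<open>D \<ge> 0\<close> in \<open>auto simp: dist_norm\<close>)
      then show ?thesis using False by (simp add: T_def dist_norm)
    qed
  qed
  obtain B where B: "\<And>y. cmod (u y) \<le> B" using u(2) unfolding bounded_iff by auto
  have AE_B: "AE y in lebesgue. cmod (u y) \<le> B" using B by simp
  have "u \<in> Linf"
  proof -
    have "Linf_norm u \<le> ennreal B" unfolding Linf_norm_def
      by (rule esssup_I) (use u(1) B in \<open>auto intro: ennreal_leI\<close>)
    then show ?thesis using u(1) unfolding Linf_def by (auto intro: le_less_trans)
  qed
  moreover have u_eq: "AE x in lebesgue. u x = ?R u x + \<phi> x"
    using AE_N
  proof eventually_elim
    case (elim x) then show ?case using fun_cong[OF u(3), of x] by (simp add: T_def)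
  qed
  moreover have "convolution_exists (Phi k) (substitution f u)"
    unfolding convolution_exists_def
    using AE_N by eventually_elim (rule R_int[OF _ u(1) AE_B])
  moreover have "AE x in lebesgue. v x = u x"
    if v: "v \<in> Linf" and sol: "solves_integral_equation k f \<phi> v" for v
  proof -
    have v_meas: "v \<in> borel_measurable lebesgue" using v by (simp add: Linf_def)
    obtain B' where B': "AE y in lebesgue. cmod (v y) \<le> B'" "B' \<ge> 0"
      using Linf_AE_bounded[OF v] by blast
    have v_eq: "AE x in lebesgue. v x = ?R v x + \<phi> x"
      using sol by (simp add: solves_integral_equation_def resolvent_def)
    have "B \<ge> 0" using B[of 0] norm_ge_zero order_trans by blast
    \<comment> \<open>The competitor \<open>v\<close> is bounded and solves the equation only almost
      everywhere, so the contraction estimate is iterated on almost-everywhere bounds, starting from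
      the crude bound \<open>B + B'\<close> on the difference.\<close>
    have "AE x in lebesgue. cmod (u x - v x) \<le> (l * K) ^ n * (B + B')" for n
    proof (induction n)
      case 0
      show ?case using AE_B B'(1)
      proof eventually_elim
        case (elim x) then show ?case using norm_triangle_ineq4[of "u x" "v x"] by simp
      qed
    next
      case (Suc n)
      have D: "(l * K) ^ n * (B + B') \<ge> 0" using l(2) K(2) \<open>B \<ge> 0\<close> B'(2) by simp
      show ?case using AE_N u_eq v_eq
      proof eventually_elim
        case (elim x)
        have "cmod (?R u x - ?R v x) \<le> l * K * ((l * K) ^ n * (B + B'))"
          by (rule R_contr[OF elim(1) u(1) AE_B v_meas B'(1) Suc.IH D])
        moreover have "u x - v x = ?R u x - ?R v x" using elim(2,3) by (metis add_diff_cancel_right)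
        ultimately show ?case by (simp add: mult_ac)
      qed
    qed
    \<comment> \<open>Only countably many exceptional sets occur, so all the bounds hold together
      outside one null set.\<close>
    then have "AE x in lebesgue. \<forall>n. cmod (u x - v x) \<le> (l * K) ^ n * (B + B')"
      by (simp add: AE_all_countable)
    then show ?thesis
    proof eventually_elim
      case (elim x)
      have "(\<lambda>n. (l * K) ^ n * (B + B')) \<longlonglongrightarrow> 0"
        using l(2) K(2) lK by (intro tendsto_mult_left_zero LIMSEQ_power_zero) auto
      then have "cmod (u x - v x) \<le> 0"
        by (rule LIMSEQ_le_const) (use elim in auto)
      then show ?case by simp
    qed
  qed
  ultimately show ?thesis
    unfolding solves_integral_equation_def resolvent_def by blast
qed

end
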